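(* The free Tortkara algebra $T(\{x,y\})$ on two generators $x,y$ is special.
   Context: All algebras are over a field $\mathbf{K}$ of characteristic $0$. A (right-)Zinbiel algebra is an algebra with product $\circ$ satisfying $a\circ(b\circ c)=(a\circ b+b\circ a)\circ c$. A Tortkara algebra is an anticommutative algebra satisfying $(ab)(cb)=J(a,b,c)b$, where $J(a,b,c)=(ab)c+(bc)a+(ca)b$ is the Jacobian. For any Zinbiel algebra $A$, the algebra $A^{(-)}$ with the same vector space and product $[a,b]=a\circ b-b\circ a$ is a Tortkara algebra. A Tortkara algebra $B$ is called special if there exists a Zinbiel algebra $A$ such that $B$ is (isomorphic to) a subalgebra of $A^{(-)}$. $T(X)$ denotes the free Tortkara algebra on the set $X$. *)

theory Defs
  imports "HOL-Algebra.Module"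
begin

section \<open>Nonassociative algebras over a field of characteristic 0\<close>

text \<open>The scalar field is an arbitrary type of class \<open>field_char_0\<close>; \<open>base_field\<close> presents it as a
  ring record, so that the module theory of HOL-Algebra applies.\<close>

definition base_field :: "'k::field_char_0 ring" where
  "base_field = \<lparr>carrier = UNIV, mult = (*), one = 1, zero = 0, add = (+)\<rparr>"

text \<open>The record type \<open>module\<close> extends \<open>ring\<close>, so it already has a multiplication.
  Its component \<open>one\<close> is never used: algebras are not assumed to be unital.\<close>

locale nonassoc_algebra = module base_field M
  for M :: "('k::field_char_0, 'a) module" (structure) +
  assumes mult_closed:
      "\<lbrakk>a \<in> carrier M; b \<in> carrier M\<rbrakk> \<Longrightarrow> a \<otimes> b \<in> carrier M"
    and mult_add_left:
      "\<lbrakk>a \<in> carrier M; b \<in> carrier M; c \<in> carrier M\<rbrakk> \<Longrightarrow> (a \<oplus> b) \<otimes> c = a \<otimes> c \<oplus> b \<otimes> c"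
    and mult_add_right:
      "\<lbrakk>a \<in> carrier M; b \<in> carrier M; c \<in> carrier M\<rbrakk> \<Longrightarrow> a \<otimes> (b \<oplus> c) = a \<otimes> b \<oplus> a \<otimes> c"
    and mult_smult_left:
      "\<lbrakk>a \<in> carrier M; b \<in> carrier M\<rbrakk> \<Longrightarrow> (r \<odot> a) \<otimes> b = r \<odot> (a \<otimes> b)"
    and mult_smult_right:
      "\<lbrakk>a \<in> carrier M; b \<in> carrier M\<rbrakk> \<Longrightarrow> a \<otimes> (r \<odot> b) = r \<odot> (a \<otimes> b)"

locale zinbiel_algebra = nonassoc_algebra +
  assumes zinbiel:
      "\<lbrakk>a \<in> carrier M; b \<in> carrier M; c \<in> carrier M\<rbrakk> \<Longrightarrow>
        a \<otimes> (b \<otimes> c) = (a \<otimes> b \<oplus> b \<otimes> a) \<otimes> c"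

definition jacobian :: "('k, 'a) module \<Rightarrow> 'a \<Rightarrow> 'a \<Rightarrow> 'a \<Rightarrow> 'a" where
  "jacobian M a b c =
    (a \<otimes>\<^bsub>M\<^esub> b) \<otimes>\<^bsub>M\<^esub> c \<oplus>\<^bsub>M\<^esub> (b \<otimes>\<^bsub>M\<^esub> c) \<otimes>\<^bsub>M\<^esub> a \<oplus>\<^bsub>M\<^esub> (c \<otimes>\<^bsub>M\<^esub> a) \<otimes>\<^bsub>M\<^esub> b"

locale tortkara_algebra = nonassoc_algebra +
  assumes anticommutative:
      "\<lbrakk>a \<in> carrier M; b \<in> carrier M\<rbrakk> \<Longrightarrow> a \<otimes> b = \<ominus> (b \<otimes> a)"
    and tortkara:
      "\<lbrakk>a \<in> carrier M; b \<in> carrier M; c \<in> carrier M\<rbrakk> \<Longrightarrow>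
        (a \<otimes> b) \<otimes> (c \<otimes> b) = jacobian M a b c \<otimes> b"

definition commutator_algebra :: "('k, 'a) module \<Rightarrow> ('k, 'a) module" where
  "commutator_algebra A = A\<lparr>mult := (\<lambda>a b. a \<otimes>\<^bsub>A\<^esub> b \<ominus>\<^bsub>A\<^esub> b \<otimes>\<^bsub>A\<^esub> a)\<rparr>"

definition nonassoc_subalgebra :: "'a set \<Rightarrow> ('k::field_char_0, 'a) module \<Rightarrow> bool" where
  "nonassoc_subalgebra S A \<longleftrightarrow> submodule S base_field A \<and> (\<forall>a\<in>S. \<forall>b\<in>S. a \<otimes>\<^bsub>A\<^esub> b \<in> S)"

definition nonassoc_hom :: "('k, 'a) module \<Rightarrow> ('k, 'b) module \<Rightarrow> ('a \<Rightarrow> 'b) set" where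
  "nonassoc_hom A B = {h. h \<in> carrier A \<rightarrow> carrier B \<and>
    (\<forall>a\<in>carrier A. \<forall>b\<in>carrier A. h (a \<oplus>\<^bsub>A\<^esub> b) = h a \<oplus>\<^bsub>B\<^esub> h b) \<and>
    (\<forall>r. \<forall>a\<in>carrier A. h (r \<odot>\<^bsub>A\<^esub> a) = r \<odot>\<^bsub>B\<^esub> h a) \<and>
    (\<forall>a\<in>carrier A. \<forall>b\<in>carrier A. h (a \<otimes>\<^bsub>A\<^esub> b) = h a \<otimes>\<^bsub>B\<^esub> h b)}"

definition nonassoc_iso :: "('k, 'a) module \<Rightarrow> ('k, 'b) module \<Rightarrow> ('a \<Rightarrow> 'b) set" where
  "nonassoc_iso A B = {h \<in> nonassoc_hom A B. bij_betw h (carrier A) (carrier B)}"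


section \<open>Algebra terms\<close>

datatype (term_scalars: 'k, gens: 'x) alg_term =
    Gen 'x
  | TZero
  | TAdd "('k, 'x) alg_term" "('k, 'x) alg_term"
  | TScale 'k "('k, 'x) alg_term"
  | TMult "('k, 'x) alg_term" "('k, 'x) alg_term"

primrec term_eval :: "('k, 'a) module \<Rightarrow> ('x \<Rightarrow> 'a) \<Rightarrow> ('k, 'x) alg_term \<Rightarrow> 'a" where
  "term_eval A f (Gen x) = f x"
| "term_eval A f TZero = \<zero>\<^bsub>A\<^esub>"
| "term_eval A f (TAdd s t) = term_eval A f s \<oplus>\<^bsub>A\<^esub> term_eval A f t"
| "term_eval A f (TScale r t) = r \<odot>\<^bsub>A\<^esub> term_eval A f t"
| "term_eval A f (TMult s t) = term_eval A f s \<otimes>\<^bsub>A\<^esub> term_eval A f t"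


section \<open>Special Tortkara algebras\<close>

text \<open>HOL cannot quantify over types inside a formula, so the carrier of the Zinbiel algebra is
  drawn from the type of algebra terms over the elements of \<open>B\<close>. This is no restriction: a Zinbiel
  algebra of any type may be replaced by the subalgebra generated by the image of \<open>B\<close>, each of whose
  elements is named by a term. See \<open>specialI\<close> below.\<close>

definition special :: "('k::field_char_0, 'b) module \<Rightarrow> bool" where
  "special B \<longleftrightarrow> tortkara_algebra B \<and>
    (\<exists>(A :: ('k, ('k, 'b) alg_term) module) S.
      zinbiel_algebra A \<and> nonassoc_subalgebra S (commutator_algebra A) \<and>
      nonassoc_iso B ((commutator_algebra A)\<lparr>carrier := S\<rparr>) \<noteq> {})"


section \<open>The free Tortkara algebra\<close>

text \<open>Equality of terms derivable from the laws of Tortkara algebras. The rules up to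
  \<open>teq_mult_scale_right\<close> are those of nonassociative algebras over the field; additive inverses are
  given by multiplication with \<open>-1\<close>.\<close>

inductive tortkara_eq :: "('k::field_char_0, 'x) alg_term \<Rightarrow> ('k, 'x) alg_term \<Rightarrow> bool" where
  teq_refl: "tortkara_eq t t"
| teq_sym: "tortkara_eq s t \<Longrightarrow> tortkara_eq t s"
| teq_trans: "tortkara_eq s t \<Longrightarrow> tortkara_eq t u \<Longrightarrow> tortkara_eq s u"
| teq_cong_add: "tortkara_eq s s' \<Longrightarrow> tortkara_eq t t' \<Longrightarrow> tortkara_eq (TAdd s t) (TAdd s' t')"
| teq_cong_scale: "tortkara_eq t t' \<Longrightarrow> tortkara_eq (TScale r t) (TScale r t')"
| teq_cong_mult: "tortkara_eq s s' \<Longrightarrow> tortkara_eq t t' \<Longrightarrow> tortkara_eq (TMult s t) (TMult s' t')"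
| teq_add_assoc: "tortkara_eq (TAdd (TAdd s t) u) (TAdd s (TAdd t u))"
| teq_add_commute: "tortkara_eq (TAdd s t) (TAdd t s)"
| teq_add_zero: "tortkara_eq (TAdd TZero t) t"
| teq_scale_zero: "tortkara_eq (TScale 0 t) TZero"
| teq_scale_one: "tortkara_eq (TScale 1 t) t"
| teq_scale_scale: "tortkara_eq (TScale (p * q) t) (TScale p (TScale q t))"
| teq_scale_add_left: "tortkara_eq (TScale (p + q) t) (TAdd (TScale p t) (TScale q t))"
| teq_scale_add_right: "tortkara_eq (TScale p (TAdd s t)) (TAdd (TScale p s) (TScale p t))"
| teq_mult_add_left: "tortkara_eq (TMult (TAdd s t) u) (TAdd (TMult s u) (TMult t u))"
| teq_mult_add_right: "tortkara_eq (TMult s (TAdd t u)) (TAdd (TMult s t) (TMult s u))"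
| teq_mult_scale_left: "tortkara_eq (TMult (TScale p s) t) (TScale p (TMult s t))"
| teq_mult_scale_right: "tortkara_eq (TMult s (TScale p t)) (TScale p (TMult s t))"
| teq_anticommutative: "tortkara_eq (TMult s t) (TScale (-1) (TMult t s))"
| teq_tortkara: "tortkara_eq (TMult (TMult a b) (TMult c b))
    (TMult (TAdd (TAdd (TMult (TMult a b) c) (TMult (TMult b c) a)) (TMult (TMult c a) b)) b)"

definition tclass :: "('k::field_char_0, 'x) alg_term \<Rightarrow> ('k, 'x) alg_term set" where
  "tclass t = {s. tortkara_eq t s}"

text \<open>The elements of \<open>free_tortkara X\<close> are the classes of the terms whose generators lie in \<open>X\<close>;
  the operations are induced by the term constructors.\<close>

definition free_tortkara :: "'x set \<Rightarrow> ('k::field_char_0, ('k, 'x) alg_term set) module" where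
  "free_tortkara X = \<lparr>
    carrier = tclass ` {t. gens t \<subseteq> X},
    mult = (\<lambda>P Q. \<Union>s\<in>P. \<Union>t\<in>Q. tclass (TMult s t)),
    one = undefined,
    zero = tclass TZero,
    add = (\<lambda>P Q. \<Union>s\<in>P. \<Union>t\<in>Q. tclass (TAdd s t)),
    smult = (\<lambda>r P. \<Union>s\<in>P. tclass (TScale r s))\<rparr>"


section \<open>Adequacy of the definitions\<close>

lemma base_field_simps [simp]:
  "carrier base_field = UNIV" "p \<otimes>\<^bsub>base_field\<^esub> q = p * q" "\<one>\<^bsub>base_field\<^esub> = 1"
  "\<zero>\<^bsub>base_field\<^esub> = 0" "p \<oplus>\<^bsub>base_field\<^esub> q = p + q"
  by (simp_all add: base_field_def)

lemma field_base_field: "field (base_field :: 'k::field_char_0 ring)"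
proof (rule cring.cring_fieldI)
  show cr: "cring (base_field :: 'k ring)"
    by (intro cringI abelian_groupI comm_monoidI)
      (auto simp: algebra_simps intro: add.left_inverse exI[of _ "- x" for x])
  show "Units (base_field :: 'k ring) = carrier base_field - {\<zero>\<^bsub>base_field\<^esub>}"
  proof -
    have "\<exists>z. z * x = 1 \<and> x * z = 1" if "x \<noteq> 0" for x :: 'k
      using that by (intro exI[of _ "inverse x"]) simp
    then show ?thesis by (auto simp: Units_def)
  qed
qed

lemma base_field_uminus [simp]: "\<ominus>\<^bsub>base_field\<^esub> p = - (p :: 'k::field_char_0)"
proof -
  interpret field "base_field :: 'k ring" by (rule field_base_field)
  show ?thesis by (rule minus_equality) auto
qed

lemma nonassoc_algebraI:
  fixes M :: "('k::field_char_0, 'a) module" (structure)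
  assumes "\<zero> \<in> carrier M"
    and "\<And>a b. \<lbrakk>a \<in> carrier M; b \<in> carrier M\<rbrakk> \<Longrightarrow> a \<oplus> b \<in> carrier M"
    and "\<And>r a. a \<in> carrier M \<Longrightarrow> r \<odot> a \<in> carrier M"
    and "\<And>a b. \<lbrakk>a \<in> carrier M; b \<in> carrier M\<rbrakk> \<Longrightarrow> a \<otimes> b \<in> carrier M"
    and "\<And>a b c. \<lbrakk>a \<in> carrier M; b \<in> carrier M; c \<in> carrier M\<rbrakk> \<Longrightarrow> (a \<oplus> b) \<oplus> c = a \<oplus> (b \<oplus> c)"
    and "\<And>a b. \<lbrakk>a \<in> carrier M; b \<in> carrier M\<rbrakk> \<Longrightarrow> a \<oplus> b = b \<oplus> a"
    and "\<And>a. a \<in> carrier M \<Longrightarrow> \<zero> \<oplus> a = a"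
    and s0: "\<And>a. a \<in> carrier M \<Longrightarrow> 0 \<odot> a = \<zero>"
    and s1: "\<And>a. a \<in> carrier M \<Longrightarrow> 1 \<odot> a = a"
    and "\<And>p q a. a \<in> carrier M \<Longrightarrow> (p * q) \<odot> a = p \<odot> (q \<odot> a)"
    and dl: "\<And>p q a. a \<in> carrier M \<Longrightarrow> (p + q) \<odot> a = p \<odot> a \<oplus> q \<odot> a"
    and "\<And>p a b. \<lbrakk>a \<in> carrier M; b \<in> carrier M\<rbrakk> \<Longrightarrow> p \<odot> (a \<oplus> b) = p \<odot> a \<oplus> p \<odot> b"
    and "\<And>a b c. \<lbrakk>a \<in> carrier M; b \<in> carrier M; c \<in> carrier M\<rbrakk> \<Longrightarrow> (a \<oplus> b) \<otimes> c = a \<otimes> c \<oplus> b \<otimes> c"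
    and "\<And>a b c. \<lbrakk>a \<in> carrier M; b \<in> carrier M; c \<in> carrier M\<rbrakk> \<Longrightarrow> a \<otimes> (b \<oplus> c) = a \<otimes> b \<oplus> a \<otimes> c"
    and "\<And>r a b. \<lbrakk>a \<in> carrier M; b \<in> carrier M\<rbrakk> \<Longrightarrow> (r \<odot> a) \<otimes> b = r \<odot> (a \<otimes> b)"
    and "\<And>r a b. \<lbrakk>a \<in> carrier M; b \<in> carrier M\<rbrakk> \<Longrightarrow> a \<otimes> (r \<odot> b) = r \<odot> (a \<otimes> b)"
  shows "nonassoc_algebra M"
proof -
  interpret F: field "base_field :: 'k ring" by (rule field_base_field)
  have inv: "\<exists>b\<in>carrier M. b \<oplus> a = \<zero>" if "a \<in> carrier M" for a
  proof
    show "(-1) \<odot> a \<in> carrier M" using that assms by blast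
    have "(-1) \<odot> a \<oplus> a = (-1 + 1) \<odot> a" using dl[OF that, of "-1" 1] s1[OF that] by simp
    then show "(-1) \<odot> a \<oplus> a = \<zero>" using s0[OF that] by simp
  qed
  have ag: "abelian_group M" by (rule abelian_groupI) (use assms inv in auto)
  have "module base_field M" by (rule moduleI) (use assms ag F.is_cring in auto)
  then show ?thesis by (rule nonassoc_algebra.intro) (unfold_locales, use assms in auto)
qed

context nonassoc_algebra
begin

lemma uminus_eq_smult: "a \<in> carrier M \<Longrightarrow> \<ominus> a = (-1) \<odot> a"
  using smult_l_minus[of 1 a] smult_one[of a] by simp

lemma minus_eq_smult:
  "a \<in> carrier M \<Longrightarrow> b \<in> carrier M \<Longrightarrow> a \<ominus> b = a \<oplus> (-1) \<odot> b"
  by (simp add: a_minus_def uminus_eq_smult)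

lemma smult_closed': "a \<in> carrier M \<Longrightarrow> r \<odot> a \<in> carrier M"
  using smult_closed by simp

lemma term_eval_closed:
  "f \<in> gens t \<rightarrow> carrier M \<Longrightarrow> term_eval M f t \<in> carrier M"
  by (induction t) (auto intro: smult_closed' mult_closed)

end


lemma commutator_algebra_simps [simp]:
  "carrier (commutator_algebra A) = carrier A" "add (commutator_algebra A) = add A"
  "zero (commutator_algebra A) = zero A" "smult (commutator_algebra A) = smult A"
  "a \<otimes>\<^bsub>commutator_algebra A\<^esub> b = a \<otimes>\<^bsub>A\<^esub> b \<ominus>\<^bsub>A\<^esub> b \<otimes>\<^bsub>A\<^esub> a"
  by (simp_all add: commutator_algebra_def)

lemma (in nonassoc_algebra) nonassoc_algebra_commutator: "nonassoc_algebra (commutator_algebra M)"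
proof -
  have sw: "p \<odot> (q \<odot> a) = q \<odot> (p \<odot> a)" if "a \<in> carrier M" for p q a
    using that smult_assoc1[of p q a] smult_assoc1[of q p a] by (simp add: mult.commute)
  have l0: "0 \<odot> a = \<zero>" if "a \<in> carrier M" for a
    using smult_l_null[OF that] by simp
  have r: "p \<odot> (a \<oplus> b) = p \<odot> a \<oplus> p \<odot> b" if "a \<in> carrier M" "b \<in> carrier M" for p a b
    using that smult_r_distr by simp
  show ?thesis
    by (rule nonassoc_algebraI)
      (use smult_assoc1 smult_l_distr smult_one in
        \<open>auto simp: minus_eq_smult l0 r sw smult_closed' mult_closed a_ac
        mult_add_left mult_add_right mult_smult_left mult_smult_right\<close>)
qed


subsection \<open>Specialness does not depend on the type of the Zinbiel algebra\<close>

lemma specialI: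
  fixes B :: "('k::field_char_0, 'b) module" and A :: "('k, 'c) module"
  assumes B: "tortkara_algebra B" and A: "zinbiel_algebra A"
    and S: "nonassoc_subalgebra S (commutator_algebra A)"
    and h: "h \<in> nonassoc_iso B ((commutator_algebra A)\<lparr>carrier := S\<rparr>)"
  shows "special B"
proof -
  interpret A: zinbiel_algebra A by fact
  define f where "f b = (if b \<in> carrier B then h b else \<zero>\<^bsub>A\<^esub>)" for b
  define ev where "ev = term_eval A f"
  define nm where "nm = inv_into UNIV ev"
  define A' where "A' = \<lparr>carrier = range (\<lambda>t. nm (ev t)), mult = (\<lambda>s t. nm (ev s \<otimes>\<^bsub>A\<^esub> ev t)),
    one = undefined, zero = nm \<zero>\<^bsub>A\<^esub>, add = (\<lambda>s t. nm (ev s \<oplus>\<^bsub>A\<^esub> ev t)),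
    smult = (\<lambda>r t. nm (r \<odot>\<^bsub>A\<^esub> ev t))\<rparr>"
  interpret CA: nonassoc_algebra "commutator_algebra A" by (rule A.nonassoc_algebra_commutator)
  have Ssub: "S \<subseteq> carrier A"
    using S CA.submoduleE(1)[of S] by (simp add: nonassoc_subalgebra_def)
  have hS: "h ` carrier B = S" and hinj: "inj_on h (carrier B)"
    using h by (auto simp: nonassoc_iso_def bij_betw_def)
  have f: "f b \<in> carrier A" for b using Ssub hS by (auto simp: f_def)
  have ev_closed [simp, intro]: "ev t \<in> carrier A" for t
    unfolding ev_def by (rule A.term_eval_closed) (use f in auto)
  have nm [simp]: "ev (nm (ev t)) = ev t" for t
    unfolding nm_def by (rule f_inv_into_f) simp
  have nm_mult [simp]: "ev (nm (ev s \<otimes>\<^bsub>A\<^esub> ev t)) = ev s \<otimes>\<^bsub>A\<^esub> ev t" for s t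
    using nm[of "TMult s t"] by (simp add: ev_def)
  have nm_add [simp]: "ev (nm (ev s \<oplus>\<^bsub>A\<^esub> ev t)) = ev s \<oplus>\<^bsub>A\<^esub> ev t" for s t
    using nm[of "TAdd s t"] by (simp add: ev_def)
  have nm_smult [simp]: "ev (nm (r \<odot>\<^bsub>A\<^esub> ev t)) = r \<odot>\<^bsub>A\<^esub> ev t" for r t
    using nm[of "TScale r t"] by (simp add: ev_def)
  have nm_zero [simp]: "ev (nm \<zero>\<^bsub>A\<^esub>) = \<zero>\<^bsub>A\<^esub>"
    using nm[of TZero] by (simp add: ev_def)
  have in_A': "nm (ev t) \<in> carrier A'" for t by (simp add: A'_def)
  have ops [simp]: "a \<otimes>\<^bsub>A'\<^esub> b = nm (ev a \<otimes>\<^bsub>A\<^esub> ev b)" "a \<oplus>\<^bsub>A'\<^esub> b = nm (ev a \<oplus>\<^bsub>A\<^esub> ev b)"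
    "r \<odot>\<^bsub>A'\<^esub> a = nm (r \<odot>\<^bsub>A\<^esub> ev a)" "\<zero>\<^bsub>A'\<^esub> = nm \<zero>\<^bsub>A\<^esub>" for a b r
    by (simp_all add: A'_def)
  have cl [simp]: "nm (ev a \<otimes>\<^bsub>A\<^esub> ev b) \<in> carrier A'" "nm (ev a \<oplus>\<^bsub>A\<^esub> ev b) \<in> carrier A'"
    "nm (r \<odot>\<^bsub>A\<^esub> ev a) \<in> carrier A'" "nm \<zero>\<^bsub>A\<^esub> \<in> carrier A'" for a b r
    using in_A'[of "TMult a b"] in_A'[of "TAdd a b"] in_A'[of "TScale r a"] in_A'[of TZero]
    by (simp_all add: ev_def)
  have nm_ev [simp]: "nm (ev s) = s" if "s \<in> carrier A'" for s
    using that by (auto simp: A'_def)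
  have sm: "0 \<odot>\<^bsub>A\<^esub> a = \<zero>\<^bsub>A\<^esub>" "1 \<odot>\<^bsub>A\<^esub> a = a" "(p * q) \<odot>\<^bsub>A\<^esub> a = p \<odot>\<^bsub>A\<^esub> (q \<odot>\<^bsub>A\<^esub> a)"
      "(p + q) \<odot>\<^bsub>A\<^esub> a = p \<odot>\<^bsub>A\<^esub> a \<oplus>\<^bsub>A\<^esub> q \<odot>\<^bsub>A\<^esub> a" if "a \<in> carrier A" for a p q
    using that A.smult_l_null[of a] A.smult_one[of a] A.smult_assoc1[of p q a]
      A.smult_l_distr[of p q a] by simp_all
  have rd: "p \<odot>\<^bsub>A\<^esub> (a \<oplus>\<^bsub>A\<^esub> b) = p \<odot>\<^bsub>A\<^esub> a \<oplus>\<^bsub>A\<^esub> p \<odot>\<^bsub>A\<^esub> b"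
    if "a \<in> carrier A" "b \<in> carrier A" for p a b
    using that A.smult_r_distr by simp
  have A'_alg: "nonassoc_algebra A'"
    by (rule nonassoc_algebraI)
      (simp_all add: sm rd A.a_ac A.mult_add_left A.mult_add_right A.mult_smult_left
        A.mult_smult_right A.mult_closed)
  have nm_symm: "ev (nm (ev a \<otimes>\<^bsub>A\<^esub> ev b \<oplus>\<^bsub>A\<^esub> ev b \<otimes>\<^bsub>A\<^esub> ev a)) =
      ev a \<otimes>\<^bsub>A\<^esub> ev b \<oplus>\<^bsub>A\<^esub> ev b \<otimes>\<^bsub>A\<^esub> ev a" for a b
    using nm[of "TAdd (TMult a b) (TMult b a)"] by (simp add: ev_def)
  interpret A': zinbiel_algebra A'
    by (intro zinbiel_algebra.intro A'_alg zinbiel_algebra_axioms.intro) (simp add: A.zinbiel nm_symm)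
  interpret CA': nonassoc_algebra "commutator_algebra A'" by (rule A'.nonassoc_algebra_commutator)
  have ev_minus: "ev (a \<ominus>\<^bsub>A'\<^esub> b) = ev a \<ominus>\<^bsub>A\<^esub> ev b" if "a \<in> carrier A'" "b \<in> carrier A'" for a b
  proof -
    have "ev (nm (ev a \<oplus>\<^bsub>A\<^esub> (-1) \<odot>\<^bsub>A\<^esub> ev b)) = ev a \<oplus>\<^bsub>A\<^esub> (-1) \<odot>\<^bsub>A\<^esub> ev b"
      using nm[of "TAdd a (TScale (-1) b)"] by (simp add: ev_def)
    then show ?thesis using that by (simp add: A'.minus_eq_smult A.minus_eq_smult)
  qed
  note nm_ev [simp del]
  have S_ev: "ev (nm a) = a" if "a \<in> S" for a
  proof -
    from that hS obtain b where "b \<in> carrier B" "a = h b" by blast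
    then have "a = ev (Gen b)" by (simp add: ev_def f_def)
    then show ?thesis using nm by blast
  qed
  have S_in: "nm a \<in> carrier A'" if "a \<in> S" for a
    using in_A'[of "nm a"] S_ev[OF that] by simp
  have subm: "submodule S base_field (commutator_algebra A)"
    and Sm: "\<And>a b. a \<in> S \<Longrightarrow> b \<in> S \<Longrightarrow> a \<otimes>\<^bsub>A\<^esub> b \<ominus>\<^bsub>A\<^esub> b \<otimes>\<^bsub>A\<^esub> a \<in> S"
    using S by (auto simp: nonassoc_subalgebra_def)
  have S0: "\<zero>\<^bsub>A\<^esub> \<in> S"
    using subgroup.one_closed[OF submodule.axioms(1)[OF subm]] by simp
  have Sadd: "\<And>a b. a \<in> S \<Longrightarrow> b \<in> S \<Longrightarrow> a \<oplus>\<^bsub>A\<^esub> b \<in> S" and Ssm: "\<And>r a. a \<in> S \<Longrightarrow> r \<odot>\<^bsub>A\<^esub> a \<in> S"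
    using CA.submoduleE(4,5)[OF subm] by auto
  have nm_minus: "nm a \<otimes>\<^bsub>A'\<^esub> nm b \<ominus>\<^bsub>A'\<^esub> nm b \<otimes>\<^bsub>A'\<^esub> nm a = nm (a \<otimes>\<^bsub>A\<^esub> b \<ominus>\<^bsub>A\<^esub> b \<otimes>\<^bsub>A\<^esub> a)"
    if "a \<in> S" "b \<in> S" for a b
  proof -
    let ?l = "nm a \<otimes>\<^bsub>A'\<^esub> nm b \<ominus>\<^bsub>A'\<^esub> nm b \<otimes>\<^bsub>A'\<^esub> nm a"
    have cm: "nm a \<otimes>\<^bsub>A'\<^esub> nm b \<in> carrier A'" "nm b \<otimes>\<^bsub>A'\<^esub> nm a \<in> carrier A'"
      by (rule A'.mult_closed; rule S_in; fact)+
    have "ev ?l = a \<otimes>\<^bsub>A\<^esub> b \<ominus>\<^bsub>A\<^esub> b \<otimes>\<^bsub>A\<^esub> a"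
    proof -
      have "ev (nm a \<otimes>\<^bsub>A'\<^esub> nm b) = a \<otimes>\<^bsub>A\<^esub> b" "ev (nm b \<otimes>\<^bsub>A'\<^esub> nm a) = b \<otimes>\<^bsub>A\<^esub> a"
        using nm_mult[of "nm a" "nm b"] nm_mult[of "nm b" "nm a"] that by (simp_all add: S_ev)
      then show ?thesis using ev_minus[OF cm] by (simp only:)
    qed
    moreover have "?l \<in> carrier A'" using cm by (rule A'.minus_closed)
    ultimately show ?thesis using nm_ev by metis
  qed
  have "submodule (nm ` S) base_field (commutator_algebra A')"
  proof (rule CA'.submoduleI)
    show "\<ominus>\<^bsub>commutator_algebra A'\<^esub> a \<in> nm ` S" if "a \<in> nm ` S" for a
      using that by (auto simp: CA'.uminus_eq_smult S_in S_ev Ssm)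
  qed (auto simp: S_in S_ev S0 Sadd Ssm)
  then have sub': "nonassoc_subalgebra (nm ` S) (commutator_algebra A')"
    by (auto simp: nonassoc_subalgebra_def nm_minus Sm simp del: ops)
  have "(\<lambda>b. nm (h b)) \<in> nonassoc_iso B ((commutator_algebra A')\<lparr>carrier := nm ` S\<rparr>)"
  proof -
    have hom: "h a \<in> S" "h (a \<oplus>\<^bsub>B\<^esub> b) = h a \<oplus>\<^bsub>A\<^esub> h b" "h (r \<odot>\<^bsub>B\<^esub> a) = r \<odot>\<^bsub>A\<^esub> h a"
      "h (a \<otimes>\<^bsub>B\<^esub> b) = h a \<otimes>\<^bsub>A\<^esub> h b \<ominus>\<^bsub>A\<^esub> h b \<otimes>\<^bsub>A\<^esub> h a"
      if "a \<in> carrier B" "b \<in> carrier B" for a b r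
      using h that by (auto simp: nonassoc_iso_def nonassoc_hom_def commutator_algebra_def)
    have "inj_on nm S" by (rule inj_on_inverseI[of _ ev]) (rule S_ev)
    then have "bij_betw (\<lambda>b. nm (h b)) (carrier B) (nm ` S)"
      using hinj hS comp_inj_on[of h "carrier B" nm]
      by (auto simp: bij_betw_def comp_def image_image)
    moreover have "nm (h a \<oplus>\<^bsub>A\<^esub> h b) = nm (h a) \<oplus>\<^bsub>A'\<^esub> nm (h b)"
      if "a \<in> carrier B" "b \<in> carrier B" for a b
      using that hom(1) by (simp add: S_ev)
    moreover have "nm (r \<odot>\<^bsub>A\<^esub> h a) = r \<odot>\<^bsub>A'\<^esub> nm (h a)" if "a \<in> carrier B" for a r
      using that hom(1) by (simp add: S_ev)
    ultimately show ?thesis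
      using hom by (auto simp: nonassoc_iso_def nonassoc_hom_def commutator_algebra_def[of A']
        nm_minus simp del: ops)
  qed
  then show ?thesis
    unfolding special_def using B A'.zinbiel_algebra_axioms sub' by blast
qed


subsection \<open>The universal property\<close>

lemma tclass_eq_iff: "tclass s = tclass t \<longleftrightarrow> tortkara_eq s t"
  by (auto simp: tclass_def intro: teq_refl teq_sym teq_trans)

lemma in_tclass_self: "t \<in> tclass t"
  by (simp add: tclass_def teq_refl)

lemma free_tortkara_simps [simp]:
  "tclass s \<otimes>\<^bsub>free_tortkara X\<^esub> tclass t = tclass (TMult s t)"
  "tclass s \<oplus>\<^bsub>free_tortkara X\<^esub> tclass t = tclass (TAdd s t)"
  "r \<odot>\<^bsub>free_tortkara X\<^esub> tclass t = tclass (TScale r t)"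
  "\<zero>\<^bsub>free_tortkara X\<^esub> = tclass TZero"
  "carrier (free_tortkara X) = tclass ` {t. gens t \<subseteq> X}"
proof -
  have teq: "tortkara_eq s' s" if "s' \<in> tclass s" for s s' :: "('a, 'b) alg_term"
    using that by (simp add: tclass_def teq_sym)
  have c: "tclass (TMult s' t') = tclass (TMult s t)" "tclass (TAdd s' t') = tclass (TAdd s t)"
      "tclass (TScale r t') = tclass (TScale r t)"
    if "s' \<in> tclass s" "t' \<in> tclass t" for s' t'
    using that[THEN teq] by (simp_all add: tclass_eq_iff teq_cong_mult teq_cong_add teq_cong_scale)
  have ne: "tclass s \<noteq> {}" "tclass t \<noteq> {}"
    using in_tclass_self by blast+
  show "tclass s \<otimes>\<^bsub>free_tortkara X\<^esub> tclass t = tclass (TMult s t)"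
    "tclass s \<oplus>\<^bsub>free_tortkara X\<^esub> tclass t = tclass (TAdd s t)"
    "r \<odot>\<^bsub>free_tortkara X\<^esub> tclass t = tclass (TScale r t)"
    by (simp_all add: free_tortkara_def c(1,2) c(3)[OF in_tclass_self] ne cong: SUP_cong_simp)
qed (simp_all add: free_tortkara_def)

theorem tortkara_algebra_free_tortkara:
  fixes X :: "'x set"
  shows "tortkara_algebra (free_tortkara X :: ('k::field_char_0, ('k, 'x) alg_term set) module)"
proof -
  have cl: "tclass t \<in> tclass ` {t. gens t \<subseteq> X}" if "gens t \<subseteq> X" for t :: "('k, 'x) alg_term"
    using that by blast
  have na: "nonassoc_algebra (free_tortkara X :: ('k, ('k, 'x) alg_term set) module)"
    by (rule nonassoc_algebraI; simp only: free_tortkara_simps; (elim imageE CollectE)?; hypsubst?)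
      (simp_all add: tclass_eq_iff cl tortkara_eq.intros(7-18))
  then interpret nonassoc_algebra "free_tortkara X :: ('k, ('k, 'x) alg_term set) module" .
  show ?thesis
  proof (intro tortkara_algebra.intro na tortkara_algebra_axioms.intro)
    fix a b :: "('k, 'x) alg_term set"
    assume ab: "a \<in> carrier (free_tortkara X)" "b \<in> carrier (free_tortkara X)"
    then obtain s t where st: "a = tclass s" "b = tclass t" by auto
    have "tclass (TMult s t) = tclass (TScale (-1) (TMult t s))"
      unfolding tclass_eq_iff by (rule teq_anticommutative)
    then show "a \<otimes>\<^bsub>free_tortkara X\<^esub> b = \<ominus>\<^bsub>free_tortkara X\<^esub> (b \<otimes>\<^bsub>free_tortkara X\<^esub> a)"
      unfolding uminus_eq_smult[OF mult_closed[OF ab(2,1)]] by (simp add: st)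
  next
    fix a b c :: "('k, 'x) alg_term set"
    assume "a \<in> carrier (free_tortkara X)" "b \<in> carrier (free_tortkara X)"
      "c \<in> carrier (free_tortkara X)"
    then obtain s t u where "a = tclass s" "b = tclass t" "c = tclass u" by auto
    then show "(a \<otimes>\<^bsub>free_tortkara X\<^esub> b) \<otimes>\<^bsub>free_tortkara X\<^esub> (c \<otimes>\<^bsub>free_tortkara X\<^esub> b) =
        jacobian (free_tortkara X) a b c \<otimes>\<^bsub>free_tortkara X\<^esub> b"
      by (simp add: jacobian_def tclass_eq_iff teq_tortkara)
  qed
qed

lemma (in tortkara_algebra) term_eval_tortkara_eq:
  assumes "tortkara_eq s t" and f: "\<And>x. f x \<in> carrier M"
  shows "term_eval M f s = term_eval M f t"
proof -
  have [simp]: "term_eval M f t \<in> carrier M" for t by (rule term_eval_closed) (use f in auto)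
  have [simp]: "0 \<odot> a = \<zero>" "1 \<odot> a = a" "(p * q) \<odot> a = p \<odot> (q \<odot> a)"
      "(p + q) \<odot> a = p \<odot> a \<oplus> q \<odot> a" if "a \<in> carrier M" for a p q
    using that smult_l_null[of a] smult_one[of a] smult_assoc1[of p q a]
      smult_l_distr[of p q a] by simp_all
  have [simp]: "p \<odot> (a \<oplus> b) = p \<odot> a \<oplus> p \<odot> b" if "a \<in> carrier M" "b \<in> carrier M" for p a b
    using that smult_r_distr by simp
  have [simp]: "term_eval M f s \<otimes> term_eval M f t \<in> carrier M" for s t by (simp add: mult_closed)
  from assms(1) show ?thesis
  proof induction
    case (teq_anticommutative s t)
    show ?case
      using anticommutative[of "term_eval M f s" "term_eval M f t"] by (simp add: uminus_eq_smult)
  next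
    case (teq_tortkara a b c)
    show ?case
      using tortkara[of "term_eval M f a" "term_eval M f b" "term_eval M f c"]
      by (simp add: jacobian_def)
  qed (simp_all add: a_ac mult_add_left mult_add_right mult_smult_left mult_smult_right)
qed

theorem free_tortkara_universal:
  fixes B :: "('k::field_char_0, 'b) module"
  assumes B: "tortkara_algebra B" and f: "f \<in> X \<rightarrow> carrier B"
  shows "\<exists>!h. h \<in> nonassoc_hom (free_tortkara X) B \<and> (\<forall>x\<in>X. h (tclass (Gen x)) = f x) \<and>
    h \<in> extensional (carrier (free_tortkara X))"
proof -
  interpret B: tortkara_algebra B by fact
  define g where "g x = (if x \<in> X then f x else \<zero>\<^bsub>B\<^esub>)" for x
  have g: "g x \<in> carrier B" for x using f by (auto simp: g_def)
  define h where "h = restrict (\<lambda>P. term_eval B g (SOME t. t \<in> P)) (carrier (free_tortkara X))"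
  have gens: "tclass t \<in> carrier (free_tortkara X)" if "gens t \<subseteq> X" for t using that by auto
  have h: "h (tclass t) = term_eval B g t" if "gens t \<subseteq> X" for t
  proof -
    have "(SOME s. s \<in> tclass t) \<in> tclass t" by (rule someI[of _ t]) (rule in_tclass_self)
    then have "term_eval B g t = term_eval B g (SOME s. s \<in> tclass t)"
      by (intro B.term_eval_tortkara_eq g) (simp add: tclass_def)
    then show ?thesis using gens[OF that] by (simp add: h_def)
  qed
  have cl: "term_eval B g t \<in> carrier B" for t
    by (rule B.term_eval_closed) (use g in auto)
  show ?thesis
  proof (rule ex1I[of _ h])
    show "h \<in> nonassoc_hom (free_tortkara X) B \<and> (\<forall>x\<in>X. h (tclass (Gen x)) = f x) \<and>
        h \<in> extensional (carrier (free_tortkara X))"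
      by (auto simp: nonassoc_hom_def h cl g_def) (simp add: h_def)
  next
    fix k assume k: "k \<in> nonassoc_hom (free_tortkara X) B \<and> (\<forall>x\<in>X. k (tclass (Gen x)) = f x) \<and>
        k \<in> extensional (carrier (free_tortkara X))"
    have "k (tclass t) = term_eval B g t" if "gens t \<subseteq> X" for t
      using that
    proof (induction t)
      case (Gen x)
      then show ?case using k by (simp add: g_def)
    next
      case TZero
      have "k (0 \<odot>\<^bsub>free_tortkara X\<^esub> tclass TZero) = 0 \<odot>\<^bsub>B\<^esub> k (tclass TZero)"
        "k (tclass TZero) \<in> carrier B"
        using k gens[of TZero] by (auto simp: nonassoc_hom_def simp del: free_tortkara_simps)
      moreover have "tclass (TScale 0 TZero) = (tclass TZero :: ('k, 'a) alg_term set)"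
        by (simp add: tclass_eq_iff teq_scale_zero)
      ultimately show ?case using B.smult_l_null[of "k (tclass TZero)"] by simp
    next
      case (TAdd s t)
      then have "k (tclass s \<oplus>\<^bsub>free_tortkara X\<^esub> tclass t) = k (tclass s) \<oplus>\<^bsub>B\<^esub> k (tclass t)"
        using k gens[of s] gens[of t] by (auto simp: nonassoc_hom_def simp del: free_tortkara_simps)
      then show ?case using TAdd by simp
    next
      case (TScale r t)
      then have "k (r \<odot>\<^bsub>free_tortkara X\<^esub> tclass t) = r \<odot>\<^bsub>B\<^esub> k (tclass t)"
        using k gens[of t] by (auto simp: nonassoc_hom_def simp del: free_tortkara_simps)
      then show ?case using TScale by simp
    next
      case (TMult s t)
      then have "k (tclass s \<otimes>\<^bsub>free_tortkara X\<^esub> tclass t) = k (tclass s) \<otimes>\<^bsub>B\<^esub> k (tclass t)"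
        using k gens[of s] gens[of t] by (auto simp: nonassoc_hom_def simp del: free_tortkara_simps)
      then show ?case using TMult by simp
    qed
    then show "k = h"
      using k h by (intro extensionalityI[of _ "carrier (free_tortkara X)"])
        (auto simp: h_def simp del: restrict_apply)
  qed
qed

end

theory Submission
  imports Defs
begin

text \<open>Let \<open>Z\<close> be the Zinbiel algebra of series in words with the half-shuffle
  \<open>u \<circ> vz = (u \<squnion> v) z\<close>. Removal \<open>\<partial>\<^sub>z\<close> of a last letter \<open>z\<close> is a derivation of the shuffle
  product with \<open>\<partial>\<^sub>z (f \<circ> g) = f \<squnion> \<partial>\<^sub>z g\<close>, so identities in \<open>Z\<close> and its commutator algebra are
  verified by differentiating them.

  In a Tortkara algebra generated by \<open>x\<close> and \<open>y\<close>, the linearized identity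
  \<open>(zu)(vw) + (zw)(vu) = J(z,u,v)w + J(z,w,v)u\<close> with generators \<open>z\<close>, \<open>w\<close> reduces every product of
  left-normed words to left-normed words. If \<open>ux + vy\<close> is mapped to 0 in \<open>Z\<close>, then comparing the
  words ending in \<open>xy\<close> yields \<open>F + E F = 0\<close> with the Euler operator
  \<open>E f = \<Sum>\<^sub>z z \<squnion> \<partial>\<^sub>z f\<close>, where \<open>F\<close> collects the images of \<open>u\<close> and \<open>v\<close>. As \<open>1 + E\<close> is injective in
  characteristic 0, induction on the length shows that the map from the free Tortkara algebra is
  injective.\<close>

section \<open>The shuffle algebra\<close>

text \<open>The head of a list is the last letter of the word it represents.\<close>

primrec shuffle_coeff :: "'l list \<Rightarrow> ('l list \<Rightarrow> 'k) \<Rightarrow> ('l list \<Rightarrow> 'k) \<Rightarrow> 'k::comm_ring_1" where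
  "shuffle_coeff [] f g = f [] * g []"
| "shuffle_coeff (z # w) f g = shuffle_coeff w (\<lambda>v. f (z # v)) g + shuffle_coeff w f (\<lambda>v. g (z # v))"

lemma shuffle_coeff_commute: "shuffle_coeff w f g = shuffle_coeff w g f"
  by (induction w arbitrary: f g) (simp_all add: mult.commute add.commute)

lemma shuffle_coeff_add_left:
  "shuffle_coeff w (\<lambda>v. f v + g v) h = shuffle_coeff w f h + shuffle_coeff w g h"
  by (induction w arbitrary: f g h) (simp_all add: algebra_simps)

lemma shuffle_coeff_add_right:
  "shuffle_coeff w h (\<lambda>v. f v + g v) = shuffle_coeff w h f + shuffle_coeff w h g"
  by (simp add: shuffle_coeff_commute[of w h] shuffle_coeff_add_left)

lemma shuffle_coeff_zero_left: "shuffle_coeff w (\<lambda>v. 0) h = 0"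
  by (induction w arbitrary: h) simp_all

lemma shuffle_coeff_const_left:
  "shuffle_coeff w (\<lambda>v. if v = [] then c else 0) h = c * h w"
  by (induction w arbitrary: h) (simp_all add: shuffle_coeff_zero_left)

text \<open>Under the Leibniz rule both sides split into the same three terms, one for each factor
  that can supply the removed letter.\<close>

lemma shuffle_coeff_assoc:
  "shuffle_coeff w (\<lambda>v. shuffle_coeff v f g) h = shuffle_coeff w f (\<lambda>v. shuffle_coeff v g h)"
  by (induction w arbitrary: f g h)
    (simp_all add: shuffle_coeff_add_left shuffle_coeff_add_right algebra_simps)

text \<open>A separate type makes the shuffle product the multiplication of a ring instance, so that
  \<open>algebra_simps\<close> settles identities between series.\<close>

typedef ('l, 'k) shuffle = "UNIV :: ('l list \<Rightarrow> 'k) set"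
  morphisms coeff Series
  by simp

setup_lifting type_definition_shuffle

instantiation shuffle :: (type, comm_ring_1) comm_ring_1
begin

lift_definition zero_shuffle :: "('a, 'b) shuffle" is "\<lambda>w. 0" .
lift_definition one_shuffle :: "('a, 'b) shuffle" is "\<lambda>w. if w = [] then 1 else 0" .
lift_definition plus_shuffle :: "('a, 'b) shuffle \<Rightarrow> ('a, 'b) shuffle \<Rightarrow> ('a, 'b) shuffle"
  is "\<lambda>f g w. f w + g w" .
lift_definition minus_shuffle :: "('a, 'b) shuffle \<Rightarrow> ('a, 'b) shuffle \<Rightarrow> ('a, 'b) shuffle"
  is "\<lambda>f g w. f w - g w" .
lift_definition uminus_shuffle :: "('a, 'b) shuffle \<Rightarrow> ('a, 'b) shuffle"
  is "\<lambda>f w. - f w" .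
lift_definition times_shuffle :: "('a, 'b) shuffle \<Rightarrow> ('a, 'b) shuffle \<Rightarrow> ('a, 'b) shuffle"
  is "\<lambda>f g w. shuffle_coeff w f g" .

instance
proof
  show "(0 :: ('a, 'b) shuffle) \<noteq> 1" by transfer (metis zero_neq_one)
qed (transfer; simp add: fun_eq_iff shuffle_coeff_assoc shuffle_coeff_add_left
    shuffle_coeff_const_left shuffle_coeff_commute algebra_simps)+

end

section \<open>Constants, letters, derivatives and the half-shuffle\<close>

lift_definition const :: "'k::comm_ring_1 \<Rightarrow> ('l, 'k) shuffle" is "\<lambda>c w. if w = [] then c else 0" .
lift_definition var :: "'l \<Rightarrow> ('l, 'k::comm_ring_1) shuffle" is "\<lambda>z w. if w = [z] then 1 else 0" .
lift_definition deriv :: "'l \<Rightarrow> ('l, 'k) shuffle \<Rightarrow> ('l, 'k) shuffle" is "\<lambda>z f w. f (z # w)" .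
lift_definition half :: "('l, 'k::comm_ring_1) shuffle \<Rightarrow> ('l, 'k) shuffle \<Rightarrow> ('l, 'k) shuffle"
  is "\<lambda>f g w. case w of [] \<Rightarrow> 0 | z # v \<Rightarrow> shuffle_coeff v f (\<lambda>u. g (z # u))" .

abbreviation ct :: "('l, 'k) shuffle \<Rightarrow> 'k" where
  "ct f \<equiv> coeff f []"

lemma coeff_Cons: "coeff f (z # w) = coeff (deriv z f) w"
  by transfer simp

lemma shuffle_eqI:
  assumes "ct f = ct g" "\<And>z. deriv z f = deriv z g"
  shows "f = g"
proof -
  have "coeff f w = coeff g w" for w
    using assms by (cases w) (simp_all add: coeff_Cons)
  then show ?thesis by (simp add: coeff_inject[symmetric] fun_eq_iff)
qed

lemma ct_simps [simp]:
  "ct 0 = 0" "ct 1 = 1" "ct (f + g) = ct f + ct g" "ct (f - g) = ct f - ct g"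
  "ct (- f) = - ct f" "ct (f * g) = ct f * ct g" "ct (const c) = c" "ct (var z) = 0"
  "ct (half f g) = 0"
  by (transfer; simp)+

lemma deriv_simps [simp]:
  "deriv z 0 = 0" "deriv z 1 = 0" "deriv z (f + g) = deriv z f + deriv z g"
  "deriv z (f - g) = deriv z f - deriv z g" "deriv z (- f) = - deriv z f"
  "deriv z (f * g) = deriv z f * g + f * deriv z g"
  "deriv z (const c) = 0" "deriv z (var a) = (if z = a then 1 else 0)"
  "deriv z (half f g) = f * deriv z g"
  by (transfer; simp add: fun_eq_iff)+

lemma coeff_simps [simp]:
  "coeff 0 w = 0" "coeff (f + g) w = coeff f w + coeff g w"
  "coeff (const c * f) w = c * coeff f w"
  by (transfer; simp add: shuffle_coeff_const_left)+

lemma const_simps: "const 0 = 0" "const 1 = 1" "const (p + q) = const p + const q"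
  "const (p * q) = const p * const q" "const (- p) = - const p"
  "const (p - q) = const p - const q"
  by (rule shuffle_eqI; simp)+

lemma half_linear:
  "half (f + g) h = half f h + half g h" "half h (f + g) = half h f + half h g"
  "half (const c * f) g = const c * half f g" "half f (const c * g) = const c * half f g"
  by (rule shuffle_eqI; simp add: algebra_simps)+

text \<open>The derivatives agree by the Leibniz rule for \<open>f * g\<close>. The hypotheses serve
  the constant term, which is 0 on the left.\<close>

lemma half_symmetrized:
  assumes "ct f = 0" "ct g = 0"
  shows "half f g + half g f = f * g"
  by (rule shuffle_eqI) (simp_all add: assms algebra_simps)

lemma half_half: "half f (half g h) = half (f * g) h"
  by (rule shuffle_eqI) (simp_all add: mult.assoc)

section \<open>The half-shuffle Zinbiel algebra\<close>

text \<open>The carrier excludes constants: \<open>half 1 1 = 0\<close>, whereas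
  \<open>half 1 h = h\<close> whenever \<open>ct h = 0\<close>, so the Zinbiel identity fails for
  the unit series.\<close>

definition shuffle_zinbiel :: "('k::field_char_0, ('l, 'k) shuffle) module" where
  "shuffle_zinbiel = \<lparr>carrier = {f. ct f = 0}, mult = half, one = undefined, zero = 0,
    add = (+), smult = (\<lambda>r f. const r * f)\<rparr>"

lemma shuffle_zinbiel_simps [simp]:
  "carrier shuffle_zinbiel = {f. ct f = 0}" "f \<otimes>\<^bsub>shuffle_zinbiel\<^esub> g = half f g"
  "f \<oplus>\<^bsub>shuffle_zinbiel\<^esub> g = f + g" "\<zero>\<^bsub>shuffle_zinbiel\<^esub> = 0" "r \<odot>\<^bsub>shuffle_zinbiel\<^esub> f = const r * f"
  by (simp_all add: shuffle_zinbiel_def)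

lemma nonassoc_algebra_shuffle:
  "nonassoc_algebra (shuffle_zinbiel :: ('k::field_char_0, ('l, 'k) shuffle) module)"
  by (rule nonassoc_algebraI) (simp_all add: const_simps half_linear add_ac mult.assoc distrib_left distrib_right)

lemma zinbiel_algebra_shuffle:
  "zinbiel_algebra (shuffle_zinbiel :: ('k::field_char_0, ('l, 'k) shuffle) module)"
  by (intro zinbiel_algebra.intro nonassoc_algebra_shuffle zinbiel_algebra_axioms.intro)
    (simp add: half_half half_symmetrized)

section \<open>The commutator of the half-shuffle\<close>

definition comm :: "('l, 'k::comm_ring_1) shuffle \<Rightarrow> ('l, 'k) shuffle \<Rightarrow> ('l, 'k) shuffle" where
  "comm f g = half f g - half g f"

lemma comm_simps [simp]:
  "ct (comm f g) = 0" "deriv z (comm f g) = f * deriv z g - g * deriv z f"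
  by (simp_all add: comm_def)

lemma minus_shuffle_zinbiel:
  fixes f g :: "('l, 'k::field_char_0) shuffle"
  assumes "ct f = 0" "ct g = 0"
  shows "f \<ominus>\<^bsub>shuffle_zinbiel\<^esub> g = f - g"
proof -
  interpret nonassoc_algebra "shuffle_zinbiel :: ('k, ('l, 'k) shuffle) module"
    by (rule nonassoc_algebra_shuffle)
  show ?thesis using assms minus_eq_smult[of f g] by (simp add: const_simps)
qed

lemma mult_commutator_shuffle [simp]:
  "half f g \<ominus>\<^bsub>shuffle_zinbiel\<^esub> half g f = comm f g"
  by (simp add: minus_shuffle_zinbiel comm_def)

text \<open>After differentiation the sides differ by twice the cyclic sum of
  \<open>c * (a * deriv z b - b * deriv z a)\<close>, which cancels. The Jacobian thus becomes an
  expression in shuffle products.\<close>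

lemma comm_jacobian:
  assumes "ct a = 0" "ct b = 0" "ct c = 0"
  shows "comm (comm a b) c + comm (comm b c) a + comm (comm c a) b =
    comm a b * c + comm b c * a + comm c a * b"
  by (rule shuffle_eqI) (simp_all add: algebra_simps assms)

text \<open>With the Jacobian in shuffle form, differentiation leaves the same cyclic sum,
  multiplied by \<open>b\<close>, as the only discrepancy.\<close>

lemma comm_tortkara:
  assumes "ct a = 0" "ct b = 0" "ct c = 0"
  shows "comm (comm a b) (comm c b) =
    comm (comm (comm a b) c + comm (comm b c) a + comm (comm c a) b) b"
  unfolding comm_jacobian[OF assms]
proof (rule shuffle_eqI)
  \<comment> \<open>The commutators also survive as factors of shuffle products; \<open>cb\<close>
    turns both orders into one atom for ring normalization.\<close>
  have cb: "comm c b = - comm b c" by (simp add: comm_def)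
  show "deriv z (comm (comm a b) (comm c b)) =
      deriv z (comm (comm a b * c + comm b c * a + comm c a * b) b)" for z
    by (simp add: cb algebra_simps)
qed simp

lemma tortkara_algebra_commutator_shuffle:
  "tortkara_algebra (commutator_algebra (shuffle_zinbiel :: ('k::field_char_0, ('l, 'k) shuffle) module))"
proof -
  interpret Z: nonassoc_algebra "shuffle_zinbiel :: ('k, ('l, 'k) shuffle) module"
    by (rule nonassoc_algebra_shuffle)
  have na: "nonassoc_algebra (commutator_algebra (shuffle_zinbiel :: ('k, ('l, 'k) shuffle) module))"
    by (rule Z.nonassoc_algebra_commutator)
  then interpret C: nonassoc_algebra "commutator_algebra (shuffle_zinbiel :: ('k, ('l, 'k) shuffle) module)" .
  show ?thesis
    by (intro tortkara_algebra.intro na tortkara_algebra_axioms.intro)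
      (simp_all add: C.uminus_eq_smult const_simps jacobian_def comm_tortkara, simp add: comm_def)
qed

section \<open>The Euler operator\<close>

definition euler :: "('l::finite, 'k::comm_ring_1) shuffle \<Rightarrow> ('l, 'k) shuffle" where
  "euler f = (\<Sum>z\<in>UNIV. var z * deriv z f)"

text \<open>\<open>euler_power k = E \<circ> (E - 1) \<circ> \<dots> \<circ> (E - (k - 1))\<close> for \<open>E = euler\<close>, because \<open>E\<close> is a
  derivation fixing the letters. On \<open>E f = - f\<close> it acts as \<open>(-1)^k k!\<close>.\<close>

primrec euler_power :: "nat \<Rightarrow> ('l::finite, 'k::comm_ring_1) shuffle \<Rightarrow> ('l, 'k) shuffle" where
  "euler_power 0 f = f"
| "euler_power (Suc k) f = (\<Sum>z\<in>UNIV. var z * euler_power k (deriv z f))"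

lemma euler_simps:
  "euler (f + g) = euler f + euler g" "euler (f * g) = euler f * g + f * euler g"
  "euler (const c) = 0" "euler (var z) = var z" "euler 0 = 0"
  by (simp_all add: euler_def algebra_simps sum.distrib sum_distrib_left
      if_distrib[of "(*) _"] cong: if_cong)

lemma euler_sum: "euler (\<Sum>z\<in>S. f z) = (\<Sum>z\<in>S. euler (f z))"
  by (induction S rule: infinite_finite_induct) (simp_all add: euler_simps)

text \<open>In each summand the derivation hits either the outer letter, which adds one copy, or the
  inner factor, to which the induction hypothesis applies. This is the recursion of falling
  factorials.\<close>

lemma euler_euler_power:
  "euler (euler_power k f) = const (of_nat k) * euler_power k f + euler_power (Suc k) f"
proof (induction k arbitrary: f)
  case 0
  then show ?case by (simp add: euler_def const_simps)
next
  case (Suc k)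
  then show ?case
    by (simp only: euler_power.simps(2) euler_sum euler_simps Suc)
      (simp add: algebra_simps const_simps sum.distrib sum_distrib_left)
qed

lemma coeff_sum [simp]: "coeff (\<Sum>z\<in>S. f z) w = (\<Sum>z\<in>S. coeff (f z) w)"
  by (induction S rule: infinite_finite_induct) simp_all

text \<open>Shuffling with a letter lengthens every word by one.\<close>

lemma coeff_var_mult_eq_0:
  assumes "\<And>v. length v < length w \<Longrightarrow> coeff g v = 0"
  shows "coeff (var z * g) w = 0"
  using assms
proof (induction w arbitrary: g)
  case (Cons a w)
  have "coeff (var z * deriv a g) w = 0"
    by (rule Cons.IH) (use Cons.prems[of "a # v" for v] in \<open>simp add: coeff_Cons\<close>)
  then show ?case using Cons.prems[of w] by (simp add: coeff_Cons)
qed simp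

lemma coeff_euler_power_eq_0: "length w < k \<Longrightarrow> coeff (euler_power k f) w = 0"
  by (induction k arbitrary: w f) (auto intro!: sum.neutral coeff_var_mult_eq_0)

text \<open>For \<open>k = length w + 1\<close> the series \<open>euler_power k f\<close> has no
  term at \<open>w\<close>, yet it equals \<open>f\<close> times \<open>(-1) ^ k * fact k\<close>,
  which is nonzero in characteristic 0.\<close>

lemma add_euler_eq_0D:
  fixes f :: "('l::finite, 'k::field_char_0) shuffle"
  assumes "f + euler f = 0"
  shows "f = 0"
proof -
  have ef: "euler f = - f" using assms by (simp add: eq_neg_iff_add_eq_0 add.commute)
  have pow: "euler_power k f = const ((-1) ^ k * of_nat (fact k)) * f" for k
  proof (induction k)
    case (Suc k)
    have "euler_power (Suc k) f = euler (euler_power k f) - const (of_nat k) * euler_power k f"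
      by (simp only: euler_euler_power) simp
    then show ?case unfolding Suc euler_simps ef
      by (simp add: const_simps algebra_simps)
  qed (simp add: const_simps)
  have "coeff f w = 0" for w
    using coeff_euler_power_eq_0[of w "Suc (length w)" f] unfolding pow by (simp del: fact_Suc)
  then show ?thesis by (simp add: coeff_inject[symmetric] fun_eq_iff)
qed

section \<open>Left-normed words in Tortkara algebras\<close>

lemma (in nonassoc_algebra) smult_simps:
  assumes "a \<in> carrier M"
  shows "0 \<odot> a = \<zero>" "1 \<odot> a = a" "p \<odot> (q \<odot> a) = (p * q) \<odot> a" "p \<odot> a \<oplus> q \<odot> a = (p + q) \<odot> a"
  using assms smult_l_null[of a] smult_one[of a] smult_assoc1[of p q a] smult_l_distr[of p q a]
  by simp_all

lemma (in nonassoc_algebra) smult_add: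
  assumes "a \<in> carrier M" "b \<in> carrier M"
  shows "p \<odot> (a \<oplus> b) = p \<odot> a \<oplus> p \<odot> b"
  using assms smult_r_distr by simp

lemma (in nonassoc_algebra) mult_zero:
  assumes "a \<in> carrier M"
  shows "\<zero> \<otimes> a = \<zero>" "a \<otimes> \<zero> = \<zero>"
  using mult_smult_left[of a a 0] mult_smult_right[of a a 0] assms mult_closed[of a a]
  by (simp_all add: smult_simps)

lemma (in nonassoc_algebra) add_left_cancel':
  assumes "a \<oplus> b = a \<oplus> c" "a \<in> carrier M" "b \<in> carrier M" "c \<in> carrier M"
  shows "b = c"
  using arg_cong[OF assms(1), of "\<lambda>d. \<ominus> a \<oplus> d"]
  unfolding r_neg1[OF assms(2,3)] r_neg1[OF assms(2,4)] .

lemma (in nonassoc_algebra) eq_of_add_uminus_eq_zero: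
  assumes "a \<oplus> (-1) \<odot> b = \<zero>" "a \<in> carrier M" "b \<in> carrier M"
  shows "a = b"
proof (rule add_left_cancel')
  show "(-1) \<odot> b \<oplus> a = (-1) \<odot> b \<oplus> b"
    using assms(1) l_neg[OF assms(3)] a_comm[OF assms(2) smult_closed'[OF assms(3)]]
    unfolding uminus_eq_smult[OF assms(3)] by metis
qed (use assms in \<open>simp_all add: smult_closed'\<close>)

section \<open>Consequences of the Tortkara identity\<close>

context tortkara_algebra
begin

lemma mult_self: "a \<otimes> a = \<zero>" if "a \<in> carrier M"
proof -
  have aa: "a \<otimes> a \<in> carrier M" using that by (simp add: mult_closed)
  then have "\<ominus> (a \<otimes> a) \<oplus> a \<otimes> a = \<zero>" by (rule l_neg)
  then have "a \<otimes> a \<oplus> a \<otimes> a = \<zero>" using anticommutative[OF that that] by simp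
  then have "(1 + 1) \<odot> (a \<otimes> a) = \<zero>"
    using aa smult_l_distr[of 1 1 "a \<otimes> a"] by (simp add: smult_simps(2))
  then have "(1 / 2) \<odot> (2 \<odot> (a \<otimes> a)) = \<zero>" using smult_r_null by simp
  then show ?thesis using aa by (simp add: smult_simps(2,3))
qed

lemma jacobian_closed:
  "\<lbrakk>a \<in> carrier M; b \<in> carrier M; c \<in> carrier M\<rbrakk> \<Longrightarrow> jacobian M a b c \<in> carrier M"
  by (simp add: jacobian_def mult_closed)

text \<open>Polarization: the identity is applied to \<open>b \<oplus> d\<close>, and its instances
  at \<open>b\<close> and at \<open>d\<close>, collected in \<open>?P\<close>, are
  cancelled.\<close>

lemma tortkara_linearized:
  assumes c: "a \<in> carrier M" "b \<in> carrier M" "c \<in> carrier M" "d \<in> carrier M"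
  shows "(a \<otimes> b) \<otimes> (c \<otimes> d) \<oplus> (a \<otimes> d) \<otimes> (c \<otimes> b) = jacobian M a b c \<otimes> d \<oplus> jacobian M a d c \<otimes> b"
    (is "?Q \<oplus> ?R = ?S \<oplus> ?T")
proof -
  let ?P = "(a \<otimes> b) \<otimes> (c \<otimes> b) \<oplus> (a \<otimes> d) \<otimes> (c \<otimes> d)"
  have j: "jacobian M a (b \<oplus> d) c = jacobian M a b c \<oplus> jacobian M a d c"
    using c by (simp add: jacobian_def mult_add_left mult_add_right mult_closed a_ac)
  have "?P \<oplus> (?Q \<oplus> ?R) = (a \<otimes> (b \<oplus> d)) \<otimes> (c \<otimes> (b \<oplus> d))"
    using c by (simp add: mult_add_left mult_add_right mult_closed a_ac)
  also have "\<dots> = jacobian M a (b \<oplus> d) c \<otimes> (b \<oplus> d)"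
    using c by (intro tortkara) simp_all
  also have "\<dots> = (jacobian M a b c \<otimes> b \<oplus> jacobian M a d c \<otimes> d) \<oplus> (?S \<oplus> ?T)"
    unfolding j using c by (simp add: mult_add_left mult_add_right mult_closed jacobian_closed a_ac)
  also have "jacobian M a b c \<otimes> b \<oplus> jacobian M a d c \<otimes> d = ?P"
    using c by (simp add: tortkara)
  finally show ?thesis
    by (rule add_left_cancel') (use c in \<open>simp_all add: mult_closed jacobian_closed\<close>)
qed

end

section \<open>The span of left-normed words in two generators\<close>

locale tortkara_pair = tortkara_algebra M
  for M :: "('k::field_char_0, 'a) module" (structure) +
  fixes x y
  assumes x_closed: "x \<in> carrier M" and y_closed: "y \<in> carrier M"
begin

text \<open>This is the span of the products \<open>(...(z1 z2)...) zk\<close> of at most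
  \<open>n\<close> generators. A bound in place of an exact length allows inhomogeneous
  sums.\<close>

primrec leftnormed :: "nat \<Rightarrow> 'a set" where
  "leftnormed 0 = {\<zero>}"
| "leftnormed (Suc n) =
    {\<alpha> \<odot> x \<oplus> \<beta> \<odot> y \<oplus> (u \<otimes> x \<oplus> v \<otimes> y) | \<alpha> \<beta> u v. u \<in> leftnormed n \<and> v \<in> leftnormed n}"

lemma leftnormed_closed: "t \<in> leftnormed n \<Longrightarrow> t \<in> carrier M"
  by (induction n arbitrary: t) (auto simp: x_closed y_closed mult_closed smult_closed')

lemmas closed = x_closed y_closed mult_closed smult_closed' leftnormed_closed

lemma leftnormed_SucI:
  "\<lbrakk>u \<in> leftnormed n; v \<in> leftnormed n; t = \<alpha> \<odot> x \<oplus> \<beta> \<odot> y \<oplus> (u \<otimes> x \<oplus> v \<otimes> y)\<rbrakk> \<Longrightarrow> t \<in> leftnormed (Suc n)"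
  by auto

lemma leftnormed_SucE:
  assumes "t \<in> leftnormed (Suc n)"
  obtains \<alpha> \<beta> u v where "u \<in> leftnormed n" "v \<in> leftnormed n"
    "t = \<alpha> \<odot> x \<oplus> \<beta> \<odot> y \<oplus> (u \<otimes> x \<oplus> v \<otimes> y)"
  using assms by auto

declare leftnormed.simps(2) [simp del]

lemma leftnormed_zero: "\<zero> \<in> leftnormed n"
proof (induction n)
  case (Suc n)
  then show ?case
    by (rule leftnormed_SucI[where \<alpha>=0 and \<beta>=0, OF _ Suc]) (simp add: smult_simps closed mult_zero)
qed simp

lemma leftnormed_add: "\<lbrakk>s \<in> leftnormed n; t \<in> leftnormed n\<rbrakk> \<Longrightarrow> s \<oplus> t \<in> leftnormed n"
proof (induction n arbitrary: s t)
  case (Suc n)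
  obtain \<alpha> \<beta> u v where s: "u \<in> leftnormed n" "v \<in> leftnormed n"
    "s = \<alpha> \<odot> x \<oplus> \<beta> \<odot> y \<oplus> (u \<otimes> x \<oplus> v \<otimes> y)" using Suc.prems(1) by (rule leftnormed_SucE)
  obtain \<alpha>' \<beta>' u' v' where t: "u' \<in> leftnormed n" "v' \<in> leftnormed n"
    "t = \<alpha>' \<odot> x \<oplus> \<beta>' \<odot> y \<oplus> (u' \<otimes> x \<oplus> v' \<otimes> y)" using Suc.prems(2) by (rule leftnormed_SucE)
  show ?case
  proof (rule leftnormed_SucI)
    show "u \<oplus> u' \<in> leftnormed n" "v \<oplus> v' \<in> leftnormed n" using Suc.IH s t by auto
    show "s \<oplus> t = (\<alpha> + \<alpha>') \<odot> x \<oplus> (\<beta> + \<beta>') \<odot> y \<oplus> ((u \<oplus> u') \<otimes> x \<oplus> (v \<oplus> v') \<otimes> y)"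
      using s t by (simp add: smult_simps(4)[symmetric] mult_add_left closed a_ac)
  qed
qed simp

lemma leftnormed_smult: "t \<in> leftnormed n \<Longrightarrow> r \<odot> t \<in> leftnormed n"
proof (induction n arbitrary: t)
  case 0
  then show ?case using smult_r_null by simp
next
  case (Suc n)
  obtain \<alpha> \<beta> u v where t: "u \<in> leftnormed n" "v \<in> leftnormed n"
    "t = \<alpha> \<odot> x \<oplus> \<beta> \<odot> y \<oplus> (u \<otimes> x \<oplus> v \<otimes> y)" using Suc.prems by (rule leftnormed_SucE)
  show ?case
  proof (rule leftnormed_SucI)
    show "r \<odot> u \<in> leftnormed n" "r \<odot> v \<in> leftnormed n" using Suc.IH t by auto
    show "r \<odot> t = (r * \<alpha>) \<odot> x \<oplus> (r * \<beta>) \<odot> y \<oplus> ((r \<odot> u) \<otimes> x \<oplus> (r \<odot> v) \<otimes> y)"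
      using t by (simp add: smult_add smult_simps(3) mult_smult_left closed)
  qed
qed

lemma leftnormed_uminus: "t \<in> leftnormed n \<Longrightarrow> \<ominus> t \<in> leftnormed n"
  by (simp add: uminus_eq_smult leftnormed_closed leftnormed_smult)

lemma leftnormed_mono: "\<lbrakk>t \<in> leftnormed m; m \<le> n\<rbrakk> \<Longrightarrow> t \<in> leftnormed n"
proof (induction m arbitrary: t n)
  case 0
  then show ?case by (simp add: leftnormed_zero)
next
  case (Suc m)
  obtain k where n: "n = Suc k" "m \<le> k" using Suc.prems(2) by (cases n) auto
  show ?case using Suc.prems(1) unfolding n(1)
    by (elim leftnormed_SucE, intro leftnormed_SucI[OF Suc.IH[OF _ n(2)] Suc.IH[OF _ n(2)]])
qed

lemma gen_closed: "z \<in> {x, y} \<Longrightarrow> z \<in> carrier M"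
  using closed by auto

lemma leftnormed_gen: "z \<in> {x, y} \<Longrightarrow> z \<in> leftnormed (Suc n)"
proof -
  assume z: "z \<in> {x, y}"
  show ?thesis
  proof (rule leftnormed_SucI[OF leftnormed_zero leftnormed_zero])
    show "z = (if z = x then 1 else 0) \<odot> x \<oplus> (if z = x then 0 else 1) \<odot> y \<oplus> (\<zero> \<otimes> x \<oplus> \<zero> \<otimes> y)"
      using z by (auto simp: smult_simps mult_zero closed)
  qed
qed

lemma leftnormed_swap:
  assumes "a \<otimes> b \<in> leftnormed n" "a \<in> carrier M" "b \<in> carrier M"
  shows "b \<otimes> a \<in> leftnormed n"
  using leftnormed_uminus[OF assms(1)] anticommutative[OF assms(3,2)] by simp

lemma leftnormed_mult_gen:
  assumes u: "u \<in> leftnormed n" and z: "z \<in> {x, y}"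
  shows "u \<otimes> z \<in> leftnormed (Suc n)"
proof -
  have "u \<otimes> z = 0 \<odot> x \<oplus> 0 \<odot> y \<oplus> ((if z = x then u else \<zero>) \<otimes> x \<oplus> (if z = x then \<zero> else u) \<otimes> y)"
    using z u by (auto simp: smult_simps mult_zero closed)
  then show ?thesis by (rule leftnormed_SucI[rotated 2]) (use u leftnormed_zero in auto)
qed

lemma leftnormed_gen_mult:
  assumes "u \<in> leftnormed n" "z \<in> {x, y}"
  shows "z \<otimes> u \<in> leftnormed (Suc n)"
  using leftnormed_mult_gen[OF assms] assms by (intro leftnormed_swap[of u z]) (auto intro: closed)

text \<open>Linearity reduces the left factor to a generator or a word with its last letter split
  off. With \<open>leftnormed_swap\<close> it serves for right factors too.\<close>

lemma leftnormed_mult_left: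
  assumes p: "p \<in> leftnormed (Suc m)" and q: "q \<in> carrier M"
    and gen: "\<And>z. z \<in> {x, y} \<Longrightarrow> z \<otimes> q \<in> leftnormed k"
    and step: "\<And>u z. \<lbrakk>u \<in> leftnormed m; z \<in> {x, y}\<rbrakk> \<Longrightarrow> (u \<otimes> z) \<otimes> q \<in> leftnormed k"
  shows "p \<otimes> q \<in> leftnormed k"
proof -
  obtain \<alpha> \<beta> u v where u: "u \<in> leftnormed m" "v \<in> leftnormed m"
    "p = \<alpha> \<odot> x \<oplus> \<beta> \<odot> y \<oplus> (u \<otimes> x \<oplus> v \<otimes> y)" using p by (rule leftnormed_SucE)
  have "p \<otimes> q = \<alpha> \<odot> (x \<otimes> q) \<oplus> \<beta> \<odot> (y \<otimes> q) \<oplus> ((u \<otimes> x) \<otimes> q \<oplus> (v \<otimes> y) \<otimes> q)"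
    using u q by (simp add: mult_add_left mult_smult_left closed)
  then show ?thesis
    using u gen step by (auto intro!: leftnormed_add leftnormed_smult)
qed

lemma leftnormed_cancel:
  assumes "p \<oplus> q \<in> leftnormed n" "q \<in> leftnormed n" "p \<in> carrier M"
  shows "p \<in> leftnormed n"
proof -
  have "p = (p \<oplus> q) \<oplus> \<ominus> q" using assms leftnormed_closed[OF assms(2)] by (simp add: a_assoc r_neg)
  then show ?thesis using assms by (metis leftnormed_add leftnormed_uminus)
qed

text \<open>Here the number of generators matters: for distinct \<open>z\<close> and
  \<open>w\<close> the last letter of a word in \<open>v\<close> is one of them. The Tortkara
  identity then applies with that shared letter and leaves a Jacobian covered by induction.\<close>

lemma leftnormed_gens_mult:
  assumes "z \<in> {x, y}" "w \<in> {x, y}" "v \<in> leftnormed k"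
  shows "(z \<otimes> w) \<otimes> v \<in> leftnormed (Suc (Suc k))"
  using assms
proof (induction k arbitrary: z w v)
  case 0
  then show ?case by (simp add: mult_zero mult_closed gen_closed leftnormed_zero)
next
  case (Suc k)
  note gc = gen_closed[OF Suc.prems(1)] gen_closed[OF Suc.prems(2)]
  have key: "(a \<otimes> b) \<otimes> (u \<otimes> b) \<in> leftnormed (Suc (Suc (Suc k)))"
    if u: "u \<in> leftnormed k" and ab: "a \<in> {x, y}" "b \<in> {x, y}" for a b u
  proof -
    have J: "jacobian M a b u \<in> leftnormed (Suc (Suc k))"
      unfolding jacobian_def
      by (intro leftnormed_add Suc.IH leftnormed_mult_gen leftnormed_gen_mult u ab)
    show ?thesis
      unfolding tortkara[OF gen_closed[OF ab(1)] gen_closed[OF ab(2)] leftnormed_closed[OF u]]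
      by (rule leftnormed_mult_gen[OF J ab(2)])
  qed
  have "v \<otimes> (z \<otimes> w) \<in> leftnormed (Suc (Suc (Suc k)))"
  proof (rule leftnormed_mult_left[OF Suc.prems(3)])
    show "g \<otimes> (z \<otimes> w) \<in> leftnormed (Suc (Suc (Suc k)))" if "g \<in> {x, y}" for g
      by (intro leftnormed_gen_mult leftnormed_gen that Suc.prems)
    show "(u \<otimes> g) \<otimes> (z \<otimes> w) \<in> leftnormed (Suc (Suc (Suc k)))"
      if u: "u \<in> leftnormed k" and g: "g \<in> {x, y}" for u g
    proof -
      note uc = leftnormed_closed[OF u] and gg = gen_closed[OF g]
      \<comment> \<open>Three letters from a set of at most two elements cannot be distinct.\<close>
      consider "z = w" | "g = w" | "g = z" using g Suc.prems by auto
      then have "(z \<otimes> w) \<otimes> (u \<otimes> g) \<in> leftnormed (Suc (Suc (Suc k)))"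
      proof cases
        case 1
        then show ?thesis using gc gg uc by (simp add: mult_self mult_zero mult_closed leftnormed_zero)
      next
        case 2
        then show ?thesis using key[OF u] Suc.prems by simp
      next
        case 3
        have "(z \<otimes> w) \<otimes> (u \<otimes> g) = (-1) \<odot> ((w \<otimes> z) \<otimes> (u \<otimes> g))"
          using gc gg uc anticommutative[of z w]
          by (simp add: uminus_eq_smult mult_smult_left mult_closed)
        then show ?thesis using key[OF u, of w z] 3 Suc.prems by (simp add: leftnormed_smult)
      qed
      then show ?thesis by (rule leftnormed_swap) (use gc gg uc in \<open>simp_all add: mult_closed\<close>)
    qed
  qed (use gc in \<open>simp add: mult_closed\<close>)
  then show ?case
    by (rule leftnormed_swap) (use gc Suc.prems(3) leftnormed_closed in \<open>auto simp: mult_closed\<close>)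
qed

text \<open>Nested induction on both lengths. In the linearized identity all terms except
  \<open>(z \<otimes> u) \<otimes> (v \<otimes> w)\<close> involve shorter factors or a product with
  \<open>z \<otimes> w\<close>, which \<open>leftnormed_gens_mult\<close> covers.\<close>

lemma leftnormed_mult: "\<lbrakk>p \<in> leftnormed m; q \<in> leftnormed n\<rbrakk> \<Longrightarrow> p \<otimes> q \<in> leftnormed (m + n)"
proof (induction m arbitrary: p q n)
  case 0
  then show ?case by (simp add: mult_zero closed leftnormed_zero)
next
  case (Suc m)
  note outer = Suc.IH
  have outer': "q \<otimes> p \<in> leftnormed (m + n)" if "p \<in> leftnormed m" "q \<in> leftnormed n" for p q n
    using outer[OF that] that by (intro leftnormed_swap[of p q]) (auto intro: closed)
  show ?case
    using Suc.prems
  proof (induction n arbitrary: p q)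
    case 0
    then show ?case by (simp add: mult_zero closed leftnormed_zero)
  next
    case (Suc n)
    let ?k = "Suc (Suc (m + n))"
    have key: "(u \<otimes> z) \<otimes> (v \<otimes> w) \<in> leftnormed ?k"
      if u: "u \<in> leftnormed m" and v: "v \<in> leftnormed n" and zw: "z \<in> {x, y}" "w \<in> {x, y}"
      for u v z w
    proof -
      note c = gen_closed[OF zw(1)] gen_closed[OF zw(2)] leftnormed_closed[OF u] leftnormed_closed[OF v]
      \<comment> \<open>The left factor has the full length \<open>Suc m\<close>, so this term needs
        the inner induction, on the right factor.\<close>
      have "(z \<otimes> u) \<otimes> v \<in> leftnormed (Suc m + n)"
        by (rule Suc.IH[OF leftnormed_gen_mult[OF u zw(1)] v])
      moreover have "(u \<otimes> v) \<otimes> z \<in> leftnormed (Suc (m + n))"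
        by (intro leftnormed_mult_gen outer u v zw)
      moreover have "(v \<otimes> z) \<otimes> u \<in> leftnormed (m + Suc n)"
        by (intro outer' leftnormed_mult_gen u v zw)
      ultimately have "jacobian M z u v \<in> leftnormed (Suc (m + n))"
        unfolding jacobian_def by (simp add: leftnormed_add)
      then have J1: "jacobian M z u v \<otimes> w \<in> leftnormed ?k"
        using zw by (intro leftnormed_mult_gen)
      have "jacobian M z w v \<in> leftnormed (Suc (Suc n))"
        unfolding jacobian_def
        by (intro leftnormed_add leftnormed_gens_mult leftnormed_mult_gen leftnormed_gen_mult v zw)
      \<comment> \<open>The outer hypothesis holds for right factors of any length, here
        \<open>n + 2\<close>.\<close>
      from outer'[OF u this] have J2: "jacobian M z w v \<otimes> u \<in> leftnormed ?k" by simp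
      have "(z \<otimes> u) \<otimes> (v \<otimes> w) \<oplus> (z \<otimes> w) \<otimes> (v \<otimes> u) \<in> leftnormed ?k"
        using c J1 J2 by (simp add: tortkara_linearized leftnormed_add)
      moreover have "(z \<otimes> w) \<otimes> (v \<otimes> u) \<in> leftnormed ?k"
        by (intro leftnormed_gens_mult outer' u v zw)
      ultimately have "(z \<otimes> u) \<otimes> (v \<otimes> w) \<in> leftnormed ?k"
        by (rule leftnormed_cancel) (use c in \<open>simp add: mult_closed\<close>)
      moreover have "(u \<otimes> z) \<otimes> (v \<otimes> w) = (-1) \<odot> ((z \<otimes> u) \<otimes> (v \<otimes> w))"
        using c anticommutative[of u z] by (simp add: uminus_eq_smult mult_smult_left mult_closed)
      ultimately show ?thesis by (simp add: leftnormed_smult)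
    qed
    note qc = leftnormed_closed[OF Suc.prems(2)]
    have "p \<otimes> q \<in> leftnormed ?k"
    proof (rule leftnormed_mult_left[OF Suc.prems(1) qc])
      show "z \<otimes> q \<in> leftnormed ?k" if "z \<in> {x, y}" for z
        by (rule leftnormed_mono[OF leftnormed_gen_mult[OF Suc.prems(2) that]]) simp
      fix u z assume u: "u \<in> leftnormed m" and z: "z \<in> {x, y}"
      note uz = leftnormed_mult_gen[OF u z]
      note uzc = leftnormed_closed[OF uz]
      have "q \<otimes> (u \<otimes> z) \<in> leftnormed ?k"
      proof (rule leftnormed_mult_left[OF Suc.prems(2) uzc])
        show "w \<otimes> (u \<otimes> z) \<in> leftnormed ?k" if "w \<in> {x, y}" for w
          by (rule leftnormed_mono[OF leftnormed_gen_mult[OF uz that]]) simp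
        show "(v \<otimes> w) \<otimes> (u \<otimes> z) \<in> leftnormed ?k" if "v \<in> leftnormed n" "w \<in> {x, y}" for v w
          using key[OF u that(1) z that(2)]
          by (rule leftnormed_swap) (use uzc that gen_closed in \<open>auto simp: closed\<close>)
      qed
      then show "(u \<otimes> z) \<otimes> q \<in> leftnormed ?k" using qc uzc by (rule leftnormed_swap)
    qed
    then show ?case by simp
  qed
qed

lemma term_eval_leftnormed:
  "f ` gens t \<subseteq> {x, y} \<Longrightarrow> \<exists>n. term_eval M f t \<in> leftnormed n"
proof (induction t)
  case (Gen a)
  then show ?case using leftnormed_gen[of "f a"] by auto
next
  case TZero
  then show ?case using leftnormed_zero by auto
next
  case (TAdd s t)
  then obtain m n where "term_eval M f s \<in> leftnormed m" "term_eval M f t \<in> leftnormed n" by auto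
  then have "term_eval M f s \<in> leftnormed (m + n)" "term_eval M f t \<in> leftnormed (m + n)"
    by (auto intro: leftnormed_mono)
  then show ?case using leftnormed_add by auto
next
  case (TScale r t)
  then obtain n where "term_eval M f t \<in> leftnormed n" by auto
  from leftnormed_smult[OF this, of r] show ?case by auto
next
  case (TMult s t)
  then obtain m n where "term_eval M f s \<in> leftnormed m" "term_eval M f t \<in> leftnormed n" by auto
  from leftnormed_mult[OF this] show ?case by auto
qed

end

section \<open>Division by two, and series without terms of higher degree\<close>

lemma shuffle_eq_uminus_self:
  fixes f :: "('l, 'k::field_char_0) shuffle"
  assumes "f = - f"
  shows "f = 0"
proof -
  have "const (1 + 1) * f = f + f" by (simp only: const_simps distrib_right mult_1_left)
  also have "\<dots> = 0" by (metis assms add.right_inverse)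
  finally have "const (1 / 2 * (1 + 1)) * f = 0" by (simp only: const_simps(4) mult.assoc) simp
  then show ?thesis by (simp add: const_simps(2))
qed

lemma shuffle_linear_eq:
  fixes g :: "(bool, 'k::comm_ring_1) shuffle"
  assumes "ct g = 0" "\<And>z w. deriv z (deriv w g) = 0"
  shows "g = const (ct (deriv True g)) * var True + const (ct (deriv False g)) * var False"
proof (rule shuffle_eqI)
  fix z
  have "deriv z g = const (ct (deriv z g))" by (rule shuffle_eqI) (simp_all add: assms)
  also have "\<dots> = deriv z (const (ct (deriv True g)) * var True + const (ct (deriv False g)) * var False)"
    by (cases z) simp_all
  finally show "deriv z g = \<dots>" .
qed (simp add: assms)

section \<open>Injectivity\<close>

locale tortkara_pair_hom = tortkara_pair M x y
  for M :: "('k::field_char_0, 'a) module" (structure) and x y +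
  fixes h :: "'a \<Rightarrow> (bool, 'k) shuffle"
  assumes hom: "h \<in> nonassoc_hom M (commutator_algebra shuffle_zinbiel)"
    and hx: "h x = var True" and hy: "h y = var False"
begin

lemma h_simps:
  assumes "a \<in> carrier M"
  shows "ct (h a) = 0" "h (r \<odot> a) = const r * h a"
    "b \<in> carrier M \<Longrightarrow> h (a \<oplus> b) = h a + h b"
    "b \<in> carrier M \<Longrightarrow> h (a \<otimes> b) = comm (h a) (h b)"
  using hom assms by (auto simp: nonassoc_hom_def Pi_iff)

lemma h_zero: "h \<zero> = 0"
  using h_simps(2)[of \<zero> 0] by (simp add: smult_simps const_simps)

lemma h_step:
  assumes "u \<in> carrier M" "v \<in> carrier M"
  shows "h (\<alpha> \<odot> x \<oplus> \<beta> \<odot> y \<oplus> (u \<otimes> x \<oplus> v \<otimes> y)) =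
    const \<alpha> * var True + const \<beta> * var False + (comm (h u) (var True) + comm (h v) (var False))"
  using assms by (simp add: h_simps closed hx hy)

text \<open>A second derivative of \<open>comm f (var a)\<close> consists of two terms with first
  derivatives of \<open>f\<close>, which alternate in \<open>z\<close> and \<open>w\<close>, and of
  \<open>- var a * deriv z (deriv w f)\<close>, which alternates by induction.\<close>

lemma deriv_deriv_h:
  assumes "t \<in> leftnormed n"
  shows "deriv z (deriv w (h t)) = - deriv w (deriv z (h t))"
  using assms
proof (induction n arbitrary: t)
  case 0
  then show ?case by (simp add: h_zero)
next
  case (Suc n)
  obtain \<alpha> \<beta> u v where u: "u \<in> leftnormed n" "v \<in> leftnormed n"
    "t = \<alpha> \<odot> x \<oplus> \<beta> \<odot> y \<oplus> (u \<otimes> x \<oplus> v \<otimes> y)" using Suc.prems by (rule leftnormed_SucE)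
  show ?case
    unfolding u(3) h_step[OF u(1,2)[THEN leftnormed_closed]]
    by (simp add: algebra_simps Suc.IH[OF u(1)] Suc.IH[OF u(2)])
qed

text \<open>The second derivatives of \<open>h t\<close> alternate, so a mixed one determines \<open>h t\<close> up to linear
  terms. Applied to \<open>t = u x + v y\<close>, it is \<open>- (F + euler F)\<close> for the series \<open>F\<close> below.\<close>

lemma h_eq_zeroD:
  assumes "t \<in> leftnormed n" "h t = 0"
  shows "t = \<zero>"
  using assms
proof (induction n arbitrary: t)
  case (Suc n)
  obtain \<alpha> \<beta> u v where uv: "u \<in> leftnormed n" "v \<in> leftnormed n"
    and t: "t = \<alpha> \<odot> x \<oplus> \<beta> \<odot> y \<oplus> (u \<otimes> x \<oplus> v \<otimes> y)" using Suc.prems(1) by (rule leftnormed_SucE)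
  note c = uv[THEN leftnormed_closed]
  have ht: "const \<alpha> * var True + const \<beta> * var False +
      (comm (h u) (var True) + comm (h v) (var False)) = 0" (is "?t = 0")
    using Suc.prems(2) unfolding t h_step[OF c] .
  have ct0: "ct (h u) = 0" "ct (h v) = 0" using c h_simps(1) by auto
  \<comment> \<open>The commutators contribute no linear terms, because \<open>h u\<close> and
    \<open>h v\<close> have no constant term.\<close>
  have ab: "\<alpha> = 0" "\<beta> = 0"
    using arg_cong[OF ht, of "\<lambda>f. ct (deriv True f)"] arg_cong[OF ht, of "\<lambda>f. ct (deriv False f)"]
    by (simp_all add: ct0)
  note alt = deriv_deriv_h[OF uv(1)] deriv_deriv_h[OF uv(2)]
  have diag: "deriv z (deriv z (h u)) = 0" "deriv z (deriv z (h v)) = 0" for z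
    using shuffle_eq_uminus_self alt by blast+
  define F where "F = deriv False (h u) - deriv True (h v)"
  have dF: "deriv True F = deriv True (deriv False (h u))" "deriv False F = deriv True (deriv False (h v))"
    using alt(2)[of False True] by (simp_all add: F_def diag)
  have "F + euler F = - deriv True (deriv False ?t)"
    by (simp add: euler_def UNIV_bool dF) (simp add: F_def algebra_simps)
  also have "\<dots> = 0" unfolding ht by simp
  finally have F0: "F = 0" by (rule add_euler_eq_0D)
  have dd: "deriv z (deriv w (h u)) = 0" "deriv z (deriv w (h v)) = 0" for z w
    using dF alt(1)[of False True] alt(2)[of False True] diag unfolding F0
    by (cases z; cases w; simp)+
  define a b c where "a = ct (deriv True (h u))" and "b = ct (deriv False (h u))"
    and "c = ct (deriv False (h v))"
  \<comment> \<open>\<open>F = 0\<close> also equates two linear coefficients: \<open>u\<close> and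
    \<open>v\<close> will be \<open>a x + b y\<close> and \<open>b x + c y\<close>, so that
    \<open>u x + v y = b (y x + x y) = 0\<close>.\<close>
  have b': "b = ct (deriv True (h v))" using F0 by (simp add: b_def F_def)
  have hu: "h u = const a * var True + const b * var False"
    unfolding a_def b_def by (rule shuffle_linear_eq) (simp_all add: ct0 dd)
  have hv: "h v = const b * var True + const c * var False"
    unfolding b' c_def by (rule shuffle_linear_eq) (simp_all add: ct0 dd)
  \<comment> \<open>The induction hypothesis, applied to the difference of \<open>s\<close> and the
    linear element, lifts the linear form from the image to the algebra. For \<open>n = 0\<close>
    the generators need not lie in \<open>leftnormed n\<close>, hence the case split.\<close>
  have lin: "s = p \<odot> x \<oplus> q \<odot> y"
    if s: "s \<in> leftnormed n" and hs: "h s = const p * var True + const q * var False" for s p q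
  proof (cases n)
    case 0
    then have s0: "s = \<zero>" using s by simp
    then have "const p * var True + const q * var False = (0 :: (bool, 'k) shuffle)" using hs h_zero by simp
    from arg_cong[OF this, of "\<lambda>f. ct (deriv True f)"] arg_cong[OF this, of "\<lambda>f. ct (deriv False f)"]
    show ?thesis by (simp add: s0 smult_simps closed)
  next
    case (Suc k)
    let ?l = "p \<odot> x \<oplus> q \<odot> y"
    have l: "?l \<in> carrier M" by (simp add: closed)
    note sc = leftnormed_closed[OF s]
    have "s \<oplus> (-1) \<odot> ?l \<in> leftnormed n"
      unfolding Suc
      by (intro leftnormed_add[OF s[unfolded Suc]] leftnormed_add leftnormed_smult leftnormed_gen) simp_all
    moreover have "h (s \<oplus> (-1) \<odot> ?l) = 0"
      using sc by (simp add: h_simps closed hs hx hy const_simps)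
    ultimately have "s \<oplus> (-1) \<odot> ?l = \<zero>" by (rule Suc.IH)
    then show ?thesis using sc l by (rule eq_of_add_uminus_eq_zero)
  qed
  have yx: "y \<otimes> x = (-1) \<odot> (x \<otimes> y)"
    using anticommutative[of y x] by (simp add: uminus_eq_smult closed)
  have "b \<odot> (x \<otimes> y) \<oplus> (b * -1) \<odot> (x \<otimes> y) = \<zero>"
    by (simp add: smult_simps closed del: mult_minus_right mult_1_right)
  then show ?case
    unfolding t ab lin[OF uv(1) hu] lin[OF uv(2) hv]
    by (simp add: smult_simps(1,3) closed mult_add_left mult_smult_left mult_self yx smult_r_null a_comm)
qed simp

lemma h_inj:
  assumes "\<And>t. t \<in> carrier M \<Longrightarrow> \<exists>n. t \<in> leftnormed n"
  shows "inj_on h (carrier M)"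
proof (rule inj_onI)
  fix a b assume ab: "a \<in> carrier M" "b \<in> carrier M" "h a = h b"
  have "a \<oplus> (-1) \<odot> b \<in> carrier M" using ab by (simp add: closed)
  then obtain n where "a \<oplus> (-1) \<odot> b \<in> leftnormed n" using assms by blast
  moreover have "h (a \<oplus> (-1) \<odot> b) = 0" using ab by (simp add: h_simps closed const_simps)
  ultimately have "a \<oplus> (-1) \<odot> b = \<zero>" by (rule h_eq_zeroD)
  then show "a = b" using ab(1,2) by (rule eq_of_add_uminus_eq_zero)
qed

end

text \<open>Every element of the free algebra is thus the value of a term at the generators, which
  puts it within reach of \<open>term_eval_leftnormed\<close>.\<close>

lemma term_eval_free_tortkara:
  "term_eval (free_tortkara X) (\<lambda>a. tclass (Gen a)) t = tclass t"
  by (induction t) simp_all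

theorem theorem2p5:
  fixes x y :: 'x
  assumes "x \<noteq> y"
  shows "special (free_tortkara {x, y} :: ('k::field_char_0, ('k, 'x) alg_term set) module)"
proof -
  let ?T = "free_tortkara {x, y} :: ('k, ('k, 'x) alg_term set) module"
  let ?Z = "shuffle_zinbiel :: ('k, (bool, 'k) shuffle) module"
  let ?C = "commutator_algebra ?Z"
  have T: "tortkara_algebra ?T" by (rule tortkara_algebra_free_tortkara)
  interpret C: tortkara_algebra ?C by (rule tortkara_algebra_commutator_shuffle)
  \<comment> \<open>The letter \<open>True\<close> stands for \<open>x\<close> and
    \<open>False\<close> for \<open>y\<close>; \<open>x \<noteq> y\<close> keeps the two images
    distinct.\<close>
  have "(\<lambda>z. var (z = x)) \<in> {x, y} \<rightarrow> carrier ?C" by simp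
  from free_tortkara_universal[OF C.tortkara_algebra_axioms this]
  obtain h where h: "h \<in> nonassoc_hom ?T ?C" "\<And>z. z \<in> {x, y} \<Longrightarrow> h (tclass (Gen z)) = var (z = x)"
    by blast
  interpret T: tortkara_pair_hom ?T "tclass (Gen x)" "tclass (Gen y)" h
    by (intro tortkara_pair_hom.intro tortkara_pair.intro T tortkara_pair_axioms.intro
        tortkara_pair_hom_axioms.intro h(1)) (use h(2) assms in auto)
  have "\<exists>n. t \<in> T.leftnormed n" if t: "t \<in> carrier ?T" for t
  proof -
    obtain s where "t = tclass s" "gens s \<subseteq> {x, y}"
      using t unfolding free_tortkara_simps by blast
    then show ?thesis
      using T.term_eval_leftnormed[of "\<lambda>a. tclass (Gen a)" s] by (auto simp: term_eval_free_tortkara)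
  qed
  then have inj: "inj_on h (carrier ?T)" by (rule T.h_inj)
  let ?S = "h ` carrier ?T"
  have "submodule ?S base_field ?C"
  proof (rule C.submoduleI)
    show "?S \<subseteq> carrier ?C" using h(1) by (auto simp: nonassoc_hom_def)
    have "\<zero>\<^bsub>?C\<^esub> = h \<zero>\<^bsub>?T\<^esub>" unfolding T.h_zero by simp
    then show "\<zero>\<^bsub>?C\<^esub> \<in> ?S" using T.zero_closed by (rule image_eqI)
    show sm: "r \<odot>\<^bsub>?C\<^esub> a \<in> ?S" if a: "a \<in> ?S" for r a
    proof -
      obtain s where s: "s \<in> carrier ?T" "a = h s" using a by blast
      then have "r \<odot>\<^bsub>?C\<^esub> a = h (r \<odot>\<^bsub>?T\<^esub> s)" by (simp only: T.h_simps(2)) simp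
      then show ?thesis using T.smult_closed'[OF s(1)] by blast
    qed
    show "\<ominus>\<^bsub>?C\<^esub> a \<in> ?S" if "a \<in> ?S" for a
    proof -
      have "a \<in> carrier ?C" using that T.h_simps(1) by auto
      then show ?thesis using sm[OF that, of "-1"] by (simp only: C.uminus_eq_smult)
    qed
    show "a \<oplus>\<^bsub>?C\<^esub> b \<in> ?S" if ab: "a \<in> ?S" "b \<in> ?S" for a b
    proof -
      obtain s t where s: "s \<in> carrier ?T" "a = h s" "t \<in> carrier ?T" "b = h t" using ab by blast
      then have "a \<oplus>\<^bsub>?C\<^esub> b = h (s \<oplus>\<^bsub>?T\<^esub> t)" by (simp only: T.h_simps(3)) simp
      then show ?thesis using T.a_closed[OF s(1,3)] by blast
    qed
  qed
  moreover have "a \<otimes>\<^bsub>?C\<^esub> b \<in> ?S" if ab: "a \<in> ?S" "b \<in> ?S" for a b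
  proof -
    obtain s t where s: "s \<in> carrier ?T" "a = h s" "t \<in> carrier ?T" "b = h t" using ab by blast
    then have "a \<otimes>\<^bsub>?C\<^esub> b = h (s \<otimes>\<^bsub>?T\<^esub> t)" by (simp only: T.h_simps(4)) simp
    then show ?thesis using T.mult_closed[OF s(1,3)] by blast
  qed
  ultimately have "nonassoc_subalgebra ?S ?C" by (simp only: nonassoc_subalgebra_def) blast
  moreover have "h \<in> nonassoc_iso ?T (?C\<lparr>carrier := ?S\<rparr>)"
    using h(1) inj unfolding nonassoc_iso_def nonassoc_hom_def bij_betw_def
    by (simp only: mem_Collect_eq partial_object.simps ring.simps monoid.simps module.simps) auto
  \<comment> \<open>\<open>specialI\<close> moves the embedding to a Zinbiel algebra on the type of
    terms that \<open>special\<close> prescribes.\<close>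
  ultimately show ?thesis
    using specialI[OF T zinbiel_algebra_shuffle] by blast
qed

end
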